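(* Let $z_1,z_2\in\mathbb{R}$ with $z_1>0>z_2$ and suppose $z_1/z_2=-p/q$ with $p,q$ positive integers and $\gcd(p,q)=1$. Set $m=p+q$, $\alpha=-(z_1+z_2)$ and $\beta=z_1z_2$. Then there exist $A,T\in M_m(\mathbb{C})$, with $T$ and $\Delta_A(T)$ both invertible, satisfying $$\Delta_A^2(T)+\alpha\,\Delta_A(T)+\beta\,T=0.$$ Consequently, for every $n\ge m$ the matrices $A'=A\oplus 0_{n-m}$ and $T'=T\oplus 0_{n-m}$ in $M_n(\mathbb{C})$ satisfy the same relation $\Delta_{A'}^2(T')+\alpha\,\Delta_{A'}(T')+\beta\,T'=0$, and neither $T'$ nor $\Delta_{A'}(T')$ is nilpotent.
   Context: $M_n(\mathbb{C})$ is the algebra of $n\times n$ complex matrices. For $A\in M_n(\mathbb{C})$ the inner derivation induced by $A$ is $\Delta_A(T)=AT-TA$ for $T\in M_n(\mathbb{C})$, and $\Delta_A^2(T)=\Delta_A(\Delta_A(T))$. A matrix $M$ is nilpotent if $M^k=0$ for some $k\ge 1$. $X\oplus 0_{n-m}$ denotes the block-diagonal matrix with blocks $X$ and the $(n-m)\times(n-m)$ zero matrix. *)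

theory Defs
  imports "Jordan_Normal_Form.Matrix" Complex_Main
begin

definition inner_derivation :: "complex mat \<Rightarrow> complex mat \<Rightarrow> complex mat" where
  "inner_derivation A T = A * T - T * A"

definition nilpotent_mat :: "complex mat \<Rightarrow> bool" where
  "nilpotent_mat M \<longleftrightarrow> (\<exists>k\<ge>1. M ^\<^sub>m k = 0\<^sub>m (dim_row M) (dim_col M))"

definition oplus_zero :: "complex mat \<Rightarrow> nat \<Rightarrow> complex mat" where
  "oplus_zero X k = diag_block_mat [X, 0\<^sub>m k k]"

(* The zero matrix on the right-hand side takes its dimensions from T. *)
definition quadratic_derivation_relation ::
    "real \<Rightarrow> real \<Rightarrow> complex mat \<Rightarrow> complex mat \<Rightarrow> bool" where
  "quadratic_derivation_relation \<alpha> \<beta> A T \<longleftrightarrow>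
     inner_derivation A (inner_derivation A T)
       + complex_of_real \<alpha> \<cdot>\<^sub>m inner_derivation A T
       + complex_of_real \<beta> \<cdot>\<^sub>m T
     = 0\<^sub>m (dim_row T) (dim_col T)"

end

theory Submission
  imports Defs "Jordan_Normal_Form.Determinant"
begin

text \<open>
  The quadratic factors as \<open>(\<Delta> - z1) (\<Delta> - z2) = 0\<close>, so \<open>T\<close> has to be a sum of eigenvectors of
  \<open>\<Delta>\<close> for the eigenvalues \<open>z1\<close> and \<open>z2\<close>. For diagonal \<open>A\<close> with entries \<open>a i\<close> the matrix units
  are eigenvectors, the \<open>(i, j)\<close> one with eigenvalue \<open>a i - a j\<close>; hence it suffices that every
  nonzero entry of \<open>T\<close> sits at a place where \<open>a i - a j\<close> is \<open>z1\<close> or \<open>z2\<close>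
  (\<open>quadratic_derivation_relation_mat_diag\<close>).

  Commensurability of \<open>z1\<close> and \<open>z2\<close> lets one follow such steps around closed cycles. Write
  \<open>z1 = p c\<close> and \<open>z2 = - q c\<close>, and put \<open>a i = i c\<close> for \<open>i < m = p + q\<close>. The translation
  \<open>j \<mapsto> j + p\<close> modulo \<open>m\<close> moves each index either up by \<open>p\<close> or down by \<open>q\<close>, that is, changes
  \<open>a\<close> by exactly \<open>z1\<close> or \<open>z2\<close>. Its permutation matrix is the required \<open>T\<close>. The derivation
  only rescales the nonzero entries of \<open>T\<close> by \<open>z1\<close> or \<open>z2\<close>, both nonzero, so \<open>T\<close> and
  \<open>\<Delta>(T)\<close> are both monomial matrices and thus invertible (\<open>monomial_mat_invertible\<close>).

  Padding by a zero block is compatible with sums, products and scalar multiples, so the relation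
  survives it, and a power of a padded matrix vanishes only if the same power of the original one
  does, which is impossible for an invertible matrix of positive size
  (\<open>not_nilpotent_oplus_zero\<close>).
\<close>

section \<open>Monomial matrices\<close>

definition monomial_mat :: "nat \<Rightarrow> (nat \<Rightarrow> nat) \<Rightarrow> (nat \<Rightarrow> 'a::field) \<Rightarrow> 'a mat" where
  "monomial_mat n \<sigma> w = mat n n (\<lambda>(i, j). if i = \<sigma> j then w j else 0)"

lemma monomial_mat_carrier [simp]: "monomial_mat n \<sigma> w \<in> carrier_mat n n"
  by (simp add: monomial_mat_def)

text \<open>The inverse is the transpose with inverted weights. Multiplying by it on the left is the
  convenient side, since the sum then runs over \<open>j = \<sigma> i\<close> and needs no inverse of \<open>\<sigma>\<close>; over a
  field a one-sided inverse of a square matrix is two-sided.\<close>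

lemma monomial_mat_invertible:
  fixes w :: "nat \<Rightarrow> 'a::field"
  assumes inj: "inj_on \<sigma> {..<n}" and maps: "\<sigma> ` {..<n} \<subseteq> {..<n}"
    and nz: "\<And>j. j < n \<Longrightarrow> w j \<noteq> 0"
  shows "invertible_mat (monomial_mat n \<sigma> w)"
proof -
  let ?W = "monomial_mat n \<sigma> w"
  define V where "V = mat n n (\<lambda>(j, i). if i = \<sigma> j then 1 / w j else 0)"
  have V: "V \<in> carrier_mat n n" by (simp add: V_def)
  have VW: "V * ?W = 1\<^sub>m n"
  proof (rule eq_matI)
    fix i k assume "i < dim_row (1\<^sub>m n)" "k < dim_col (1\<^sub>m n)"
    then have i: "i < n" and k: "k < n" by simp_all
    have "(V * ?W) $$ (i, k) =
        (\<Sum>j = 0..<n. (if j = \<sigma> i then 1 / w i else 0) * (if j = \<sigma> k then w k else 0))"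
      using i k by (simp add: V_def monomial_mat_def scalar_prod_def)
    also have "\<dots> = (\<Sum>j = 0..<n. if j = \<sigma> i then (if \<sigma> i = \<sigma> k then w k / w i else 0) else 0)"
      by (rule sum.cong) auto
    also have "\<dots> = (if \<sigma> i = \<sigma> k then w k / w i else 0)"
      using maps i by auto
    also have "\<dots> = 1\<^sub>m n $$ (i, k)"
      using inj_on_eq_iff[OF inj, of i k] i k nz by auto
    finally show "(V * ?W) $$ (i, k) = 1\<^sub>m n $$ (i, k)" .
  qed (simp_all add: V_def monomial_mat_def)
  have "?W * V = 1\<^sub>m n"
    by (rule mat_mult_left_right_inverse[OF V monomial_mat_carrier VW])
  with VW V show ?thesis
    unfolding invertible_mat_def inverts_mat_def
    by (auto simp: monomial_mat_def intro!: exI[of _ V])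
qed

section \<open>Inner derivations by diagonal matrices\<close>

lemma inner_derivation_carrier [simp]:
  "A \<in> carrier_mat n n \<Longrightarrow> T \<in> carrier_mat n n \<Longrightarrow> inner_derivation A T \<in> carrier_mat n n"
  unfolding inner_derivation_def by (intro minus_carrier_mat mult_carrier_mat)

lemma inner_derivation_mat_diag:
  assumes "T \<in> carrier_mat n n"
  shows "inner_derivation (mat_diag n a) T = mat n n (\<lambda>(i, j). (a i - a j) * T $$ (i, j))"
  unfolding inner_derivation_def mat_diag_mult_left[OF assms] mat_diag_mult_right[OF assms]
  by (rule eq_matI) (auto simp: algebra_simps)

text \<open>On the entry \<open>(i, j)\<close> the operator \<open>\<Delta>\<^sup>2 - (z1 + z2) \<Delta> + z1 z2\<close> is multiplication
  by \<open>(a i - a j - z1) (a i - a j - z2)\<close>.\<close>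

lemma quadratic_derivation_relation_mat_diag:
  fixes z1 z2 :: real
  assumes T: "T \<in> carrier_mat n n"
    and root: "\<And>i j. i < n \<Longrightarrow> j < n \<Longrightarrow> T $$ (i, j) \<noteq> 0 \<Longrightarrow>
      a i - a j = complex_of_real z1 \<or> a i - a j = complex_of_real z2"
  shows "quadratic_derivation_relation (- (z1 + z2)) (z1 * z2) (mat_diag n a) T"
proof -
  have entry: "(a i - a j) * ((a i - a j) * t) + complex_of_real (- (z1 + z2)) * ((a i - a j) * t)
      + complex_of_real (z1 * z2) * t = (a i - a j - z1) * (a i - a j - z2) * t" for i j t
    by (simp add: algebra_simps)
  have "(a i - a j - z1) * (a i - a j - z2) * T $$ (i, j) = 0" if "i < n" "j < n" for i j
    using root[OF that] by auto
  then show ?thesis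
    unfolding quadratic_derivation_relation_def inner_derivation_mat_diag[OF T]
      inner_derivation_mat_diag[OF mat_carrier]
    using T by (intro eq_matI) (auto simp: entry simp del: of_real_minus of_real_mult of_real_add minus_add_distrib)
qed

section \<open>Padding by a zero block\<close>

lemma oplus_zero_four_block:
  "oplus_zero X k = four_block_mat X (0\<^sub>m (dim_row X) k) (0\<^sub>m k (dim_col X)) (0\<^sub>m k k)"
  unfolding oplus_zero_def
  by (rule eq_matI) (auto simp: Let_def)

lemma oplus_zero_carrier [simp]:
  "X \<in> carrier_mat r c \<Longrightarrow> oplus_zero X k \<in> carrier_mat (r + k) (c + k)"
  by (simp add: oplus_zero_four_block)

lemma oplus_zero_index:
  assumes "i < dim_row X + k" and "j < dim_col X + k"
  shows "oplus_zero X k $$ (i, j) = (if i < dim_row X \<and> j < dim_col X then X $$ (i, j) else 0)"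
  using assms by (auto simp: oplus_zero_four_block)

lemma oplus_zero_mult:
  assumes "X \<in> carrier_mat n n" and "Y \<in> carrier_mat n n"
  shows "oplus_zero X k * oplus_zero Y k = oplus_zero (X * Y) k"
  using assms unfolding oplus_zero_four_block
  by (subst mult_four_block_mat[where ?nr1.0 = n and ?n1.0 = n and ?n2.0 = k and ?nr2.0 = k
        and ?nc1.0 = n and ?nc2.0 = k]) auto

lemma oplus_zero_dims [simp]:
  "dim_row (oplus_zero X k) = dim_row X + k" "dim_col (oplus_zero X k) = dim_col X + k"
  by (simp_all add: oplus_zero_four_block)

lemma oplus_zero_inner_derivation:
  assumes "A \<in> carrier_mat n n" and "T \<in> carrier_mat n n"
  shows "inner_derivation (oplus_zero A k) (oplus_zero T k) = oplus_zero (inner_derivation A T) k"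
  unfolding inner_derivation_def oplus_zero_mult[OF assms] oplus_zero_mult[OF assms(2,1)]
  using assms by (intro eq_matI) (auto simp: oplus_zero_index)

lemma quadratic_derivation_relation_oplus_zero:
  assumes A: "A \<in> carrier_mat n n" and T: "T \<in> carrier_mat n n"
    and rel: "quadratic_derivation_relation \<alpha> \<beta> A T"
  shows "quadratic_derivation_relation \<alpha> \<beta> (oplus_zero A k) (oplus_zero T k)"
proof -
  let ?D = "inner_derivation A T" and ?DD = "inner_derivation A (inner_derivation A T)"
  have D: "?D \<in> carrier_mat n n" and DD: "?DD \<in> carrier_mat n n" using A T by simp_all
  have "oplus_zero ?DD k + complex_of_real \<alpha> \<cdot>\<^sub>m oplus_zero ?D k + complex_of_real \<beta> \<cdot>\<^sub>m oplus_zero T k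
      = oplus_zero (?DD + complex_of_real \<alpha> \<cdot>\<^sub>m ?D + complex_of_real \<beta> \<cdot>\<^sub>m T) k"
    using T D DD by (intro eq_matI) (auto simp: oplus_zero_index)
  also have "\<dots> = oplus_zero (0\<^sub>m n n) k"
    using rel T by (simp add: quadratic_derivation_relation_def)
  also have "\<dots> = 0\<^sub>m (n + k) (n + k)"
    by (rule eq_matI) (auto simp: oplus_zero_index)
  finally show ?thesis
    unfolding quadratic_derivation_relation_def
    using A T D by (simp add: oplus_zero_inner_derivation)
qed

text \<open>The exponent must be positive: the zeroth power of a padded matrix is the full identity, not
  the padded one.\<close>

lemma oplus_zero_pow:
  assumes X: "X \<in> carrier_mat n n"
  shows "oplus_zero X k ^\<^sub>m Suc l = oplus_zero (X ^\<^sub>m Suc l) k"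
proof (induction l)
  case 0
  show ?case using X by simp
next
  case (Suc l)
  then show ?case
    using oplus_zero_mult[OF pow_carrier_mat[OF X, of "Suc l"] X] by simp
qed

lemma det_pow_mat:
  fixes X :: "'a::comm_ring_1 mat"
  assumes X: "X \<in> carrier_mat n n"
  shows "det (X ^\<^sub>m l) = det X ^ l"
proof (induction l)
  case 0
  show ?case using X by simp
next
  case (Suc l)
  then show ?case using det_mult[OF pow_carrier_mat[OF X] X] by simp
qed

lemma det_nonzero_if_invertible:
  fixes X :: "'a::field mat"
  assumes X: "X \<in> carrier_mat n n" and "invertible_mat X"
  shows "det X \<noteq> 0"
proof -
  obtain B where XB: "X * B = 1\<^sub>m n" and BX: "B * X = 1\<^sub>m (dim_row B)"
    using assms by (auto simp: invertible_mat_def inverts_mat_def)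
  have "dim_col B = n" using arg_cong[OF XB, of dim_col] by simp
  moreover have "dim_row B = n" using arg_cong[OF BX, of dim_col] X by simp
  ultimately have "B \<in> carrier_mat n n" by blast
  then have "det X * det B = 1" using det_mult[OF X, of B] XB by simp
  then show ?thesis by auto
qed

text \<open>The corner block of the \<open>l\<close>-th power is \<open>X\<close> to the \<open>l\<close>, whose determinant is a power of
  the nonzero number \<open>det X\<close>. In size zero the empty matrix is both invertible and nilpotent,
  whence the positivity of \<open>n\<close>.\<close>

lemma not_nilpotent_oplus_zero:
  assumes X: "X \<in> carrier_mat n n" and "invertible_mat X" and "n > 0"
  shows "\<not> nilpotent_mat (oplus_zero X k)"
proof
  assume "nilpotent_mat (oplus_zero X k)"
  then obtain l where "l \<ge> 1" and "oplus_zero X k ^\<^sub>m l = 0\<^sub>m (n + k) (n + k)"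
    using X by (auto simp: nilpotent_mat_def)
  then have pow0: "oplus_zero (X ^\<^sub>m l) k = 0\<^sub>m (n + k) (n + k)"
    using oplus_zero_pow[OF X, of k "l - 1"] by simp
  have Xl: "X ^\<^sub>m l \<in> carrier_mat n n" using X by (rule pow_carrier_mat)
  have "X ^\<^sub>m l = 0\<^sub>m n n"
  proof (rule eq_matI)
    fix i j assume ij: "i < dim_row (0\<^sub>m n n)" "j < dim_col (0\<^sub>m n n)"
    then have "(X ^\<^sub>m l) $$ (i, j) = oplus_zero (X ^\<^sub>m l) k $$ (i, j)"
      using carrier_matD[OF Xl] by (simp add: oplus_zero_index del: dim_row_mat dim_col_mat)
    with pow0 ij show "(X ^\<^sub>m l) $$ (i, j) = 0\<^sub>m n n $$ (i, j)" by simp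
  qed (use Xl in auto)
  then have "det X ^ l = 0"
    using det_pow_mat[OF X, of l] det_zero[OF \<open>n > 0\<close>, where ?'a = complex] by simp
  then show False
    using det_nonzero_if_invertible[OF X \<open>invertible_mat X\<close>] by simp
qed

section \<open>The cyclic construction\<close>

theorem proposition6p2:
  fixes z1 z2 \<alpha> \<beta> :: real and p q m :: nat
  assumes "z1 > 0" and "0 > z2"
    and "p > 0" and "q > 0" and "gcd p q = 1"
    and "z1 / z2 = - (real p / real q)"
    and "m = p + q" and "\<alpha> = - (z1 + z2)" and "\<beta> = z1 * z2"
  shows "\<exists>A \<in> carrier_mat m m. \<exists>T \<in> carrier_mat m m.
    invertible_mat T \<and> invertible_mat (inner_derivation A T) \<and>
    quadratic_derivation_relation \<alpha> \<beta> A T \<and>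
    (\<forall>n\<ge>m. \<forall>A' T'. A' = oplus_zero A (n - m) \<longrightarrow> T' = oplus_zero T (n - m) \<longrightarrow>
       A' \<in> carrier_mat n n \<and> T' \<in> carrier_mat n n \<and>
       quadratic_derivation_relation \<alpha> \<beta> A' T' \<and>
       \<not> nilpotent_mat T' \<and> \<not> nilpotent_mat (inner_derivation A' T'))"
proof -
  define c where "c = z1 / real p"
  have z1: "z1 = real p * c" using \<open>p > 0\<close> by (simp add: c_def)
  have z2: "z2 = - (real q * c)"
    using assms(2,3,4,6) by (simp add: c_def field_simps)
  define a :: "nat \<Rightarrow> complex" where "a i = of_real (real i * c)" for i
  \<comment> \<open>Addition of \<open>p\<close> modulo \<open>m = p + q\<close>: wrapping around means subtracting \<open>q\<close>.\<close>
  define \<sigma> where "\<sigma> j = (if j < q then j + p else j - q)" for j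
  define w :: "nat \<Rightarrow> complex" where "w j = of_real (if j < q then z1 else z2)" for j
  define A where "A = mat_diag m a"
  define T :: "complex mat" where "T = monomial_mat m \<sigma> (\<lambda>_. 1)"
  have A: "A \<in> carrier_mat m m" by (simp add: A_def)
  have T: "T \<in> carrier_mat m m" by (simp add: T_def)
  have inj: "inj_on \<sigma> {..<m}" and maps: "\<sigma> ` {..<m} \<subseteq> {..<m}"
    using \<open>m = p + q\<close> by (auto simp: \<sigma>_def inj_on_def split: if_splits)
  have step: "a (\<sigma> j) - a j = w j" for j
    by (simp add: a_def \<sigma>_def w_def z1 z2 of_nat_diff algebra_simps)
  have DT: "inner_derivation A T = monomial_mat m \<sigma> w"
    unfolding A_def inner_derivation_mat_diag[OF T]
    by (rule eq_matI) (auto simp: T_def monomial_mat_def step)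
  have invT: "invertible_mat T"
    unfolding T_def by (rule monomial_mat_invertible[OF inj maps]) simp
  have invDT: "invertible_mat (inner_derivation A T)"
    unfolding DT using \<open>z1 > 0\<close> \<open>0 > z2\<close>
    by (intro monomial_mat_invertible[OF inj maps]) (simp add: w_def)
  have rel: "quadratic_derivation_relation \<alpha> \<beta> A T"
    unfolding A_def \<open>\<alpha> = - (z1 + z2)\<close> \<open>\<beta> = z1 * z2\<close>
  proof (rule quadratic_derivation_relation_mat_diag[OF T])
    fix i j assume "i < m" "j < m" "T $$ (i, j) \<noteq> 0"
    then have "i = \<sigma> j" by (simp add: T_def monomial_mat_def split: if_splits)
    then show "a i - a j = complex_of_real z1 \<or> a i - a j = complex_of_real z2"
      using step[of j] by (simp add: w_def split: if_splits)
  qed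
  have "m > 0" using \<open>p > 0\<close> \<open>m = p + q\<close> by simp
  have pad: "oplus_zero A (n - m) \<in> carrier_mat n n \<and> oplus_zero T (n - m) \<in> carrier_mat n n \<and>
      quadratic_derivation_relation \<alpha> \<beta> (oplus_zero A (n - m)) (oplus_zero T (n - m)) \<and>
      \<not> nilpotent_mat (oplus_zero T (n - m)) \<and>
      \<not> nilpotent_mat (inner_derivation (oplus_zero A (n - m)) (oplus_zero T (n - m)))"
    if "m \<le> n" for n
    using oplus_zero_carrier[OF A, of "n - m"] oplus_zero_carrier[OF T, of "n - m"] that
      quadratic_derivation_relation_oplus_zero[OF A T rel]
      not_nilpotent_oplus_zero[OF T invT \<open>m > 0\<close>]
      not_nilpotent_oplus_zero[OF inner_derivation_carrier[OF A T] invDT \<open>m > 0\<close>]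
    by (simp add: oplus_zero_inner_derivation[OF A T])
  show ?thesis
    using A T invT invDT rel pad by blast
qed

end
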